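(* Let $\gamma>2$, let $\Lambda=\{(\rho,u,m)\in\mathbb{R}\times\mathbb{R}^2\times\mathbb{R}^2:\ |\rho|^2=|u|^2\}$, let $$K_\gamma=\{(\rho,u,m)\in\mathbb{R}\times\mathbb{R}^2\times\mathbb{R}^2:\ |\rho|=1,\ m=\tfrac12\rho u,\ |u|\le\gamma\},$$ and let $U_\gamma$ be the set of all $(\rho,u,m)\in\mathbb{R}\times\mathbb{R}^2\times\mathbb{R}^2$ with \begin{align*} |\rho|&<1,\\ |u|^2&<\gamma^2-(1-\rho^2),\\ |m-\tfrac12\rho u|&<\tfrac12(1-\rho^2),\\ |m-\tfrac12u|&<\tfrac{\gamma}{2}(1-\rho),\\ |m+\tfrac12u|&<\tfrac{\gamma}{2}(1+\rho). \end{align*} Then for every $\alpha>0$ there exists $\beta>0$, depending only on $\alpha$ and $\gamma$, such that for any $z\in U_\gamma$ with $\operatorname{dist}(z,K_\gamma)\ge\alpha$ there exists $\bar z\in\Lambda$ with $|\bar z|=1$ such that $$z+t\bar z\in U_\gamma\quad\text{whenever }|t|<\beta.$$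
   Context: The set $U_\gamma$ is the interior of the $\Lambda$-convex hull $(K_\gamma)^\Lambda$; only its explicit description given in the claim is needed. Distances and norms are Euclidean in $\mathbb{R}\times\mathbb{R}^2\times\mathbb{R}^2\cong\mathbb{R}^5$. *)

theory Defs
  imports "HOL-Analysis.Analysis"
begin

text \<open>The norm of the library's product type is the Euclidean one, so
  norm and distance on this type are those of five-dimensional Euclidean space.\<close>

type_synonym state = "real \<times> (real^2) \<times> (real^2)"

definition Lambda :: "state set" where
  "Lambda = {(\<rho>, u, m). \<bar>\<rho>\<bar>\<^sup>2 = (norm u)\<^sup>2}"

definition K :: "real \<Rightarrow> state set" where
  "K \<gamma> = {(\<rho>, u, m). \<bar>\<rho>\<bar> = 1 \<and> m = (1/2 * \<rho>) *\<^sub>R u \<and> norm u \<le> \<gamma>}"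

definition U :: "real \<Rightarrow> state set" where
  "U \<gamma> = {(\<rho>, u, m).
     \<bar>\<rho>\<bar> < 1 \<and>
     (norm u)\<^sup>2 < \<gamma>\<^sup>2 - (1 - \<rho>\<^sup>2) \<and>
     norm (m - (1/2 * \<rho>) *\<^sub>R u) < 1/2 * (1 - \<rho>\<^sup>2) \<and>
     norm (m - (1/2) *\<^sub>R u) < \<gamma>/2 * (1 - \<rho>) \<and>
     norm (m + (1/2) *\<^sub>R u) < \<gamma>/2 * (1 + \<rho>)}"

end

theory Submission
  imports Defs
begin

text \<open>
  A state with \<open>\<bar>\<rho>\<bar> < 1\<close> is the barycentre of exactly one pair of points \<open>(-1, -a, a/2)\<close> and
  \<open>(1, b, b/2)\<close> on the two planes of states that satisfy \<open>\<bar>\<rho>\<bar> = 1\<close> and \<open>m = \<rho> u / 2\<close>. In the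
  coordinates \<open>(\<rho>, a, b)\<close> three of the inequalities that define \<open>U \<gamma>\<close> become \<open>norm a < \<gamma>\<close>,
  \<open>norm b < \<gamma>\<close> and \<open>norm (a + b) < 2\<close>, and the bound on \<open>u\<close> becomes positivity of the combination
  \<open>slack\<close> of the three gaps \<open>\<gamma>\<^sup>2 - (norm a)\<^sup>2\<close>, \<open>\<gamma>\<^sup>2 - (norm b)\<^sup>2\<close> and \<open>4 - (norm (a + b))\<^sup>2\<close>
  (\<open>mix_in_U_iff\<close>).

  Take \<open>norm a \<le> norm b\<close> and move along \<open>(1, e, (b - e)/2)\<close> with a unit vector \<open>e\<close>. This
  direction lies in \<open>Lambda\<close> and keeps \<open>b\<close> fixed; it moves \<open>a\<close> with a speed
  proportional to \<open>p = a + b - 2 e\<close>, and it changes \<open>slack\<close> at the constant rate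
  \<open>-2 (u \<bullet> e - \<rho>)\<close>. A step length that depends only on \<open>\<gamma>\<close> and on the distance \<open>\<eta>\<close> of
  \<open>\<bar>\<rho>\<bar>\<close> from 1 is therefore available as soon as \<open>p\<close> is bounded by a multiple of the gaps of
  \<open>a\<close> and \<open>a + b\<close>, and \<open>u \<bullet> e - \<rho>\<close> by a multiple of \<open>slack\<close>. Lemma
  \<open>unit_vector_controlled_by_slacks\<close> finds such an \<open>e\<close>. If \<open>slack\<close> is comparable with the
  gap of \<open>a\<close>, the direction of \<open>a + b\<close> works. If not, positivity of the weights forces the gaps of \<open>a\<close>
  and \<open>a + b\<close> to be comparable, and \<open>e\<close> can be rotated slightly until \<open>u \<bullet> e = \<rho>\<close> holds exactly.

  The case \<open>norm b \<le> norm a\<close> follows by the reflection \<open>(\<rho>, u, m) \<mapsto> (-\<rho>, -u, m)\<close>, which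
  interchanges \<open>a\<close> and \<open>b\<close>. Finally, being far from \<open>K \<gamma>\<close> keeps \<open>\<bar>\<rho>\<bar>\<close> away from 1, because
  both endpoints of the barycentric decomposition lie in \<open>K \<gamma>\<close> (\<open>infdist_mix_le\<close>).
\<close>

section \<open>Barycentric coordinates\<close>

text \<open>The weights of \<open>(-1, -a, a/2)\<close> and \<open>(1, b, b/2)\<close> are \<open>(1 - \<rho>)/2\<close> and \<open>(1 + \<rho>)/2\<close>, as the
  first component requires.\<close>

definition mix :: "real \<Rightarrow> real^2 \<Rightarrow> real^2 \<Rightarrow> state" where
  "mix \<rho> a b = (\<rho>, (1/2) *\<^sub>R ((1 + \<rho>) *\<^sub>R b - (1 - \<rho>) *\<^sub>R a),
                    (1/4) *\<^sub>R ((1 + \<rho>) *\<^sub>R b + (1 - \<rho>) *\<^sub>R a))"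

text \<open>The amount by which the velocity \<open>u\<close> of \<open>mix \<rho> a b\<close> satisfies
  \<open>(norm u)\<^sup>2 \<le> \<gamma>\<^sup>2 - (1 - \<rho>\<^sup>2)\<close>, written through the gaps in the other three inequalities.
  The gap of \<open>a + b\<close> enters with a negative sign, so a positive slack bounds it by the other two.\<close>

definition slack :: "real \<Rightarrow> real \<Rightarrow> real^2 \<Rightarrow> real^2 \<Rightarrow> real" where
  "slack \<gamma> \<rho> a b = (1 - \<rho>) / 2 * (\<gamma>\<^sup>2 - (norm a)\<^sup>2) + (1 + \<rho>) / 2 * (\<gamma>\<^sup>2 - (norm b)\<^sup>2)
                    - (1 - \<rho>\<^sup>2) / 4 * (4 - (norm (a + b))\<^sup>2)"

lemma norm_velocity_mix:
  fixes a b :: "real^2"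
  shows "(norm ((1/2) *\<^sub>R ((1 + \<rho>) *\<^sub>R b - (1 - \<rho>) *\<^sub>R a)))\<^sup>2 = \<gamma>\<^sup>2 - (1 - \<rho>\<^sup>2) - slack \<gamma> \<rho> a b"
  unfolding slack_def power2_norm_eq_inner
  by (simp add: inner_diff_left inner_diff_right inner_add_left inner_add_right inner_commute[of b a]
      field_simps power2_eq_square)

lemma mix_in_U_iff:
  assumes "\<bar>\<rho>\<bar> < 1"
  shows "mix \<rho> a b \<in> U \<gamma> \<longleftrightarrow>
    norm a < \<gamma> \<and> norm b < \<gamma> \<and> norm (a + b) < 2 \<and> slack \<gamma> \<rho> a b > 0"
proof -
  let ?u = "(1/2) *\<^sub>R ((1 + \<rho>) *\<^sub>R b - (1 - \<rho>) *\<^sub>R a)"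
  let ?m = "(1/4) *\<^sub>R ((1 + \<rho>) *\<^sub>R b + (1 - \<rho>) *\<^sub>R a)"
  have pos: "1 - \<rho> > 0" "1 + \<rho> > 0" "1 - \<rho>\<^sup>2 > 0"
    using assms by (auto simp: abs_square_less_1)
  have v3: "?m - (1/2 * \<rho>) *\<^sub>R ?u = ((1 - \<rho>\<^sup>2) / 4) *\<^sub>R (a + b)"
    by (simp add: vec_eq_iff field_simps power2_eq_square)
  have v4: "?m - (1/2) *\<^sub>R ?u = ((1 - \<rho>) / 2) *\<^sub>R a" and v5: "?m + (1/2) *\<^sub>R ?u = ((1 + \<rho>) / 2) *\<^sub>R b"
    by (simp_all add: vec_eq_iff field_simps)
  have "norm (?m - (1/2 * \<rho>) *\<^sub>R ?u) < 1/2 * (1 - \<rho>\<^sup>2) \<longleftrightarrow> norm (a + b) < 2"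
  proof -
    have "norm (?m - (1/2 * \<rho>) *\<^sub>R ?u) = (1 - \<rho>\<^sup>2) / 4 * norm (a + b)"
      unfolding v3 norm_scaleR using pos by simp
    moreover have "(1 - \<rho>\<^sup>2) / 4 * norm (a + b) < (1 - \<rho>\<^sup>2) / 4 * 2 \<longleftrightarrow> norm (a + b) < 2"
      using pos by (intro mult_less_cancel_left_pos) simp
    moreover have "1/2 * (1 - \<rho>\<^sup>2) = (1 - \<rho>\<^sup>2) / 4 * 2" by simp
    ultimately show ?thesis by metis
  qed
  moreover have "norm (?m - (1/2) *\<^sub>R ?u) < \<gamma>/2 * (1 - \<rho>) \<longleftrightarrow> norm a < \<gamma>"
  proof -
    have "norm (?m - (1/2) *\<^sub>R ?u) = (1 - \<rho>) / 2 * norm a" unfolding v4 using pos by simp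
    moreover have "(1 - \<rho>) / 2 * norm a < (1 - \<rho>) / 2 * \<gamma> \<longleftrightarrow> norm a < \<gamma>" using pos by simp
    ultimately show ?thesis by (simp add: mult.commute)
  qed
  moreover have "norm (?m + (1/2) *\<^sub>R ?u) < \<gamma>/2 * (1 + \<rho>) \<longleftrightarrow> norm b < \<gamma>"
  proof -
    have "norm (?m + (1/2) *\<^sub>R ?u) = (1 + \<rho>) / 2 * norm b" unfolding v5 using pos by simp
    moreover have "(1 + \<rho>) / 2 * norm b < (1 + \<rho>) / 2 * \<gamma> \<longleftrightarrow> norm b < \<gamma>" using pos by simp
    ultimately show ?thesis by (simp add: mult.commute)
  qed
  moreover have "(norm ?u)\<^sup>2 < \<gamma>\<^sup>2 - (1 - \<rho>\<^sup>2) \<longleftrightarrow> slack \<gamma> \<rho> a b > 0"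
    unfolding norm_velocity_mix[of \<rho> b a \<gamma>] by simp
  ultimately show ?thesis
    using assms unfolding mix_def U_def by blast
qed

lemma state_eq_mix:
  assumes "\<bar>\<rho>\<bar> < 1"
  obtains a b where "(\<rho>, u, m) = mix \<rho> a b"
proof
  have "1 - \<rho> \<noteq> 0" "1 + \<rho> \<noteq> 0" using assms by auto
  then show "(\<rho>, u, m) = mix \<rho> ((1 / (1 - \<rho>)) *\<^sub>R (2 *\<^sub>R m - u)) ((1 / (1 + \<rho>)) *\<^sub>R (2 *\<^sub>R m + u))"
    unfolding mix_def by (simp add: vec_eq_iff)
qed

text \<open>The endpoint \<open>(1, b, b/2)\<close> belongs to \<open>K \<gamma>\<close> and differs from the barycentre by \<open>1 - \<rho>\<close> times
  a bounded vector.\<close>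

lemma infdist_mix_le:
  assumes "\<bar>\<rho>\<bar> < 1" "norm a \<le> \<gamma>" "norm b \<le> \<gamma>" "norm (a + b) \<le> 2"
  shows "infdist (mix \<rho> a b) (K \<gamma>) \<le> (1 - \<rho>) * (2 + \<gamma>)"
proof -
  have "(1, b, (1/2) *\<^sub>R b) \<in> K \<gamma>" using assms by (simp add: K_def)
  then have "infdist (mix \<rho> a b) (K \<gamma>) \<le> norm (mix \<rho> a b - (1, b, (1/2) *\<^sub>R b))"
    using infdist_le by (metis dist_norm)
  also have "mix \<rho> a b - (1, b, (1/2) *\<^sub>R b) = (1 - \<rho>) *\<^sub>R (- 1, - ((1/2) *\<^sub>R (a + b)), (1/4) *\<^sub>R (a - b))"
    by (simp add: mix_def vec_eq_iff field_simps)
  also have "norm \<dots> = (1 - \<rho>) * norm (- 1 :: real, - ((1/2) *\<^sub>R (a + b)), (1/4) *\<^sub>R (a - b))"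
    unfolding norm_scaleR using assms by simp
  also have "\<dots> \<le> (1 - \<rho>) * (2 + \<gamma>)"
  proof (rule mult_left_mono)
    have "norm (- 1 :: real, - ((1/2) *\<^sub>R (a + b)), (1/4) *\<^sub>R (a - b))
        \<le> norm (- 1 :: real) + (norm (- ((1/2) *\<^sub>R (a + b))) + norm ((1/4) *\<^sub>R (a - b)))"
      by (rule order_trans[OF norm_Pair_le add_left_mono[OF norm_Pair_le]])
    moreover have "norm (- ((1/2) *\<^sub>R (a + b))) \<le> 1"
      unfolding norm_minus_cancel norm_scaleR using assms by simp
    moreover have "norm ((1/4) *\<^sub>R (a - b)) \<le> \<gamma>"
    proof -
      have "norm (a - b) \<le> 4 * \<gamma>"
        using norm_triangle_ineq4[of a b] norm_ge_zero[of a] assms(2,3) by linarith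
      then show ?thesis by simp
    qed
    ultimately show "norm (- 1 :: real, - ((1/2) *\<^sub>R (a + b)), (1/4) *\<^sub>R (a - b)) \<le> 2 + \<gamma>" by simp
  qed (use assms in simp)
  finally show ?thesis .
qed

section \<open>Choice of the velocity direction\<close>

text \<open>Rotating \<open>e\<^sub>0\<close> in a plane that contains \<open>n\<close> adjusts its component along \<open>n\<close>. The cost is
  Lipschitz in the adjustment because the target component \<open>k\<close> stays away from \<open>\<plusminus>1\<close>, where the
  height \<open>sqrt (1 - k\<^sup>2)\<close> of the circle above \<open>n\<close> has unbounded slope.\<close>

lemma unit_vector_with_prescribed_component:
  fixes n e\<^sub>0 :: "'a::euclidean_space"
  assumes dim: "2 \<le> DIM('a)" and n: "norm n = 1" and e0: "norm e\<^sub>0 = 1" and k: "k\<^sup>2 \<le> 1/2"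
  obtains e where "norm e = 1" "n \<bullet> e = k" "norm (e - e\<^sub>0) \<le> 5 * \<bar>n \<bullet> e\<^sub>0 - k\<bar>"
proof -
  define f r where "f = n \<bullet> e\<^sub>0" and "r = e\<^sub>0 - f *\<^sub>R n"
  have nn: "n \<bullet> n = 1" and ee: "e\<^sub>0 \<bullet> e\<^sub>0 = 1" using n e0 by (simp_all add: norm_eq_1)
  have nr: "n \<bullet> r = 0" unfolding r_def f_def by (simp add: inner_diff_right nn)
  \<comment> \<open>\<open>n\<close> and \<open>h\<close> span the plane of rotation; if \<open>e\<^sub>0\<close> is parallel to \<open>n\<close>, any plane will do.\<close>
  obtain h where h: "norm h = 1" "n \<bullet> h = 0" "r = norm r *\<^sub>R h"
  proof (cases "r = 0")
    case True
    obtain y where "y \<noteq> 0" "orthogonal n y" using orthogonal_to_vector_exists[OF dim] by blast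
    then show ?thesis using that[of "y /\<^sub>R norm y"] True by (simp add: orthogonal_def)
  next
    case False
    then show ?thesis using that[of "r /\<^sub>R norm r"] nr by simp
  qed
  have hh: "h \<bullet> h = 1" using h by (simp add: norm_eq_1)
  define g where "g = norm r"
  have "g\<^sup>2 = r \<bullet> r" unfolding g_def by (simp add: power2_norm_eq_inner)
  also have "\<dots> = 1 - f\<^sup>2"
    unfolding r_def by (simp add: inner_diff_left inner_diff_right nn ee f_def inner_commute[of e\<^sub>0 n] power2_eq_square)
  finally have g2: "g\<^sup>2 = 1 - f\<^sup>2" .
  define s where "s = sqrt (1 - k\<^sup>2)"
  have s2: "s\<^sup>2 = 1 - k\<^sup>2" unfolding s_def using k by simp
  have "(1/2)\<^sup>2 \<le> 1 - k\<^sup>2" using k by (simp add: power_divide)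
  then have s0: "s \<ge> 1/2" unfolding s_def by (rule real_le_rsqrt)
  define e where "e = k *\<^sub>R n + s *\<^sub>R h"
  have "e \<bullet> e = 1" unfolding e_def
    using s2 by (simp add: inner_add_left inner_add_right nn hh h(2) inner_commute[of h n] power2_eq_square)
  then have "norm e = 1" by (simp add: norm_eq_1)
  moreover have "n \<bullet> e = k" unfolding e_def by (simp add: inner_add_right nn h)
  moreover have "norm (e - e\<^sub>0) \<le> 5 * \<bar>f - k\<bar>"
  proof -
    have "\<bar>f\<bar> \<le> 1" using g2 by (metis abs_square_le_1 diff_ge_0_iff_ge zero_le_power2)
    moreover have "\<bar>k\<bar> \<le> 1" using k by (simp add: flip: abs_square_le_1)
    ultimately have fk: "\<bar>f + k\<bar> \<le> 2" by simp
    have "\<bar>s - g\<bar> * (1/2) \<le> \<bar>s - g\<bar> * (s + g)"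
      using s0 by (intro mult_left_mono) (auto simp: g_def intro: add_increasing2)
    also have "\<dots> = \<bar>(s - g) * (s + g)\<bar>" using s0 by (simp add: abs_mult g_def)
    also have "(s - g) * (s + g) = (f - k) * (f + k)"
      using s2 g2 by (simp add: power2_eq_square algebra_simps)
    also have "\<bar>\<dots>\<bar> \<le> \<bar>f - k\<bar> * 2" unfolding abs_mult using fk by (intro mult_left_mono) auto
    finally have sg: "\<bar>s - g\<bar> \<le> 4 * \<bar>f - k\<bar>" by simp
    have "e - e\<^sub>0 = (k - f) *\<^sub>R n + (s - g) *\<^sub>R h"
      using h(3) unfolding e_def g_def r_def by (simp add: algebra_simps)
    also have "norm \<dots> \<le> \<bar>k - f\<bar> + \<bar>s - g\<bar>"
      by (rule order_trans[OF norm_triangle_ineq]) (simp add: n h)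
    finally show ?thesis using sg by (simp add: abs_minus_commute)
  qed
  ultimately show ?thesis using that unfolding f_def by blast
qed

lemma unit_multiple_exists:
  fixes w :: "real^2"
  obtains e where "norm e = 1" "w = norm w *\<^sub>R e"
proof (cases "w = 0")
  case True
  obtain e :: "real^2" where "norm e = 1" using vector_choose_size[of 1] by auto
  then show ?thesis using that[of e] True by simp
next
  case False
  then show ?thesis using that[of "w /\<^sub>R norm w"] by simp
qed

text \<open>The gap of \<open>a\<close> is the larger one, since \<open>norm a \<le> norm b\<close>; it therefore controls the
  gap of \<open>a + b\<close>. The unit vector in the direction of \<open>a + b\<close> always satisfies the two bounds on
  \<open>a + b - 2 e\<close>, and misses \<open>u \<bullet> e = \<rho>\<close> by a multiple of the gap of \<open>a\<close>. This is
  harmless when \<open>slack\<close> is at least a multiple of that gap; otherwise the error is removed by a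
  rotation.\<close>

lemma unit_vector_controlled_by_slacks:
  fixes a b :: "real^2"
  assumes \<gamma>: "\<gamma> > 2" and \<eta>: "0 < \<eta>" "\<eta> \<le> 1 - \<bar>\<rho>\<bar>"
    and a: "norm a < \<gamma>" and ab: "norm a \<le> norm b" and b: "norm b < \<gamma>"
    and two: "norm (a + b) < 2" and E: "slack \<gamma> \<rho> a b > 0"
  defines "u \<equiv> (1/2) *\<^sub>R ((1 + \<rho>) *\<^sub>R b - (1 - \<rho>) *\<^sub>R a)"
    and "C \<equiv> 41 * (\<gamma> + 2) / \<eta>\<^sup>2"
  obtains e where "norm e = 1"
    "norm (a + b - 2 *\<^sub>R e) \<le> C * (2 - norm (a + b))"
    "norm (a + b - 2 *\<^sub>R e) \<le> 2 * C / \<eta> * (\<gamma>\<^sup>2 - (norm a)\<^sup>2)"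
    "\<bar>u \<bullet> e - \<rho>\<bar> \<le> C * slack \<gamma> \<rho> a b"
proof -
  define x y d \<delta> where "x = \<gamma>\<^sup>2 - (norm a)\<^sup>2" and "y = \<gamma>\<^sup>2 - (norm b)\<^sup>2"
    and "d = 4 - (norm (a + b))\<^sup>2" and "\<delta> = 2 - norm (a + b)"
  define S where "S = slack \<gamma> \<rho> a b"
  have S: "S = (1 - \<rho>) / 2 * x + (1 + \<rho>) / 2 * y - (1 - \<rho>\<^sup>2) / 4 * d"
    unfolding S_def slack_def x_def y_def d_def ..
  have \<rho>: "\<bar>\<rho>\<bar> \<le> 1 - \<eta>" "\<bar>\<rho>\<bar> < 1" "\<eta> \<le> 1" using \<eta> by auto
  have x0: "x > 0" and y0: "y > 0"
    unfolding x_def y_def using a b by (auto intro!: power_strict_mono)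
  have xy: "y \<le> x" unfolding x_def y_def using ab by (auto intro!: power_mono)
  have \<delta>0: "\<delta> > 0" unfolding \<delta>_def using two by simp
  have d\<delta>: "d = \<delta> * (2 + norm (a + b))" unfolding d_def \<delta>_def by (simp add: power2_eq_square algebra_simps)
  have d2: "2 * \<delta> \<le> d" and d4: "d \<le> 4 * \<delta>"
    using mult_left_mono[of 2 "2 + norm (a + b)" \<delta>] mult_left_mono[of "2 + norm (a + b)" 4 \<delta>] two \<delta>0
    unfolding d\<delta> by auto
  have eta_le: "\<eta> \<le> 1 - \<rho>\<^sup>2"
  proof -
    have "\<rho>\<^sup>2 \<le> \<bar>\<rho>\<bar>" using \<rho> mult_left_le[of "\<bar>\<rho>\<bar>" "\<bar>\<rho>\<bar>"] by (simp add: power2_eq_square)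
    then show ?thesis using \<rho> by simp
  qed
  have dx: "\<eta> * d \<le> 4 * x"
  proof -
    have "\<eta> * d \<le> (1 - \<rho>\<^sup>2) * d" using eta_le d2 \<delta>0 by (intro mult_right_mono) auto
    also have "\<dots> < 4 * ((1 - \<rho>) / 2 * x + (1 + \<rho>) / 2 * y)" using E S unfolding S_def by simp
    also have "\<dots> \<le> 4 * ((1 - \<rho>) / 2 * x + (1 + \<rho>) / 2 * x)"
      using xy \<rho> by (intro mult_left_mono add_left_mono) auto
    also have "\<dots> = 4 * x" by (simp add: field_simps)
    finally show ?thesis by simp
  qed
  have C1: "C \<ge> 1"
  proof -
    have "\<eta>\<^sup>2 \<le> 1" using \<eta> \<rho> by (simp add: power_le_one)
    then show ?thesis unfolding C_def using \<gamma> \<eta> by (simp add: field_simps)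
  qed
  obtain e0 where e0: "norm e0 = 1" "a + b = norm (a + b) *\<^sub>R e0" using unit_multiple_exists by blast
  have p0: "norm (a + b - 2 *\<^sub>R e0) = \<delta>"
  proof -
    have "a + b - 2 *\<^sub>R e0 = (norm (a + b) - 2) *\<^sub>R e0" using e0(2) by (simp add: scaleR_left_diff_distrib)
    then show ?thesis using e0(1) two unfolding \<delta>_def by simp
  qed
  have u2: "(norm u)\<^sup>2 = \<gamma>\<^sup>2 - (1 - \<rho>\<^sup>2) - S" unfolding u_def S_def by (rule norm_velocity_mix)
  have u\<gamma>: "norm u \<le> \<gamma>"
  proof (rule power2_le_imp_le)
    show "(norm u)\<^sup>2 \<le> \<gamma>\<^sup>2" unfolding u2 using E eta_le \<eta> unfolding S_def by simp
  qed (use \<gamma> in simp)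
  have j0: "\<bar>u \<bullet> e0 - \<rho>\<bar> \<le> (\<gamma> + 2) * x / \<eta>"
  proof -
    \<comment> \<open>If \<open>norm a = norm b\<close> and \<open>norm (a + b) = 2\<close>, then \<open>u \<bullet> e0 = \<rho>\<close> exactly; in general the
      error is linear in the deviations from these equalities.\<close>
    have "u \<bullet> (a + b) = (x - y) / 2 + \<rho> / 2 * (4 - d)"
      unfolding u_def x_def y_def d_def power2_norm_eq_inner
      by (simp add: inner_diff_left inner_add_left inner_add_right inner_commute[of b a] field_simps)
    then have "4 * (u \<bullet> e0 - \<rho>) = (x - y) - \<rho> * d - 2 * (u \<bullet> (a + b - 2 *\<^sub>R e0))"
      by (simp add: inner_diff_right field_simps)
    moreover have "\<bar>\<rho> * d\<bar> \<le> d"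
      using \<rho> d2 \<delta>0 unfolding abs_mult by (simp add: mult_left_le_one_le)
    moreover have "\<bar>u \<bullet> (a + b - 2 *\<^sub>R e0)\<bar> \<le> \<gamma> * \<delta>"
      using Cauchy_Schwarz_ineq2[of u "a + b - 2 *\<^sub>R e0"] mult_right_mono[OF u\<gamma>, of \<delta>] \<delta>0 unfolding p0 by linarith
    ultimately have "4 * \<bar>u \<bullet> e0 - \<rho>\<bar> \<le> x + d + 2 * (\<gamma> * \<delta>)"
      using xy y0 by linarith
    moreover have "\<gamma> * \<delta> \<le> \<gamma> * (d / 2)" using d2 \<gamma> by (intro mult_left_mono) auto
    ultimately have "\<bar>u \<bullet> e0 - \<rho>\<bar> \<le> x / 4 + (1 + \<gamma>) * d / 4" by (simp add: field_simps)
    then have "\<eta> * \<bar>u \<bullet> e0 - \<rho>\<bar> \<le> \<eta> * (x / 4 + (1 + \<gamma>) * d / 4)" using \<eta> by (intro mult_left_mono) auto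
    also have "\<dots> = \<eta> * x / 4 + (1 + \<gamma>) / 4 * (\<eta> * d)" by (simp add: algebra_simps)
    also have "\<dots> \<le> x / 4 + (1 + \<gamma>) / 4 * (4 * x)"
      using \<rho> x0 \<gamma> dx \<eta> by (intro add_mono mult_left_mono) (auto simp: mult_left_le_one_le)
    also have "\<dots> \<le> (\<gamma> + 2) * x" using x0 by (simp add: field_simps)
    finally show ?thesis using \<eta> by (simp add: field_simps)
  qed
  have "\<exists>e. norm e = 1 \<and> norm (a + b - 2 *\<^sub>R e) \<le> C * \<delta> \<and> \<bar>u \<bullet> e - \<rho>\<bar> \<le> C * S"
  proof (cases "S \<ge> \<eta> / 4 * x")
    case True
    have "(\<gamma> + 2) * x / \<eta> = (4 * (\<gamma> + 2) / \<eta>\<^sup>2) * (\<eta> / 4 * x)"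
      using \<eta> by (simp add: field_simps power2_eq_square)
    also have "\<dots> \<le> (4 * (\<gamma> + 2) / \<eta>\<^sup>2) * S" using True \<gamma> by (intro mult_left_mono) auto
    also have "\<dots> \<le> C * S"
      unfolding C_def using E \<gamma> \<eta> unfolding S_def by (intro mult_right_mono divide_right_mono) auto
    finally have "\<bar>u \<bullet> e0 - \<rho>\<bar> \<le> C * S" using j0 by simp
    moreover have "norm (a + b - 2 *\<^sub>R e0) \<le> C * \<delta>" unfolding p0 using C1 \<delta>0 by simp
    ultimately show ?thesis using e0 by blast
  next
    case False
    \<comment> \<open>A small slack and \<open>\<gamma> > 2\<close> make \<open>u\<close> long compared with \<open>\<rho>\<close>, which keeps the
      prescribed component \<open>\<rho> / norm u\<close> of the rotated vector away from \<open>\<plusminus>1\<close>.\<close>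
    have "\<eta> * x \<le> 1 * x" using \<rho> x0 by (intro mult_right_mono) auto
    then have "S < x / 4" using False by simp
    also have "\<dots> \<le> \<gamma>\<^sup>2 / 4" unfolding x_def by simp
    finally have "(norm u)\<^sup>2 \<ge> 3/4 * \<gamma>\<^sup>2 - 1 + \<rho>\<^sup>2" unfolding u2 by simp
    moreover have "\<gamma>\<^sup>2 > 4" using \<gamma> power_strict_mono[of 2 \<gamma> 2] by simp
    ultimately have ubig: "(norm u)\<^sup>2 \<ge> 2 + \<rho>\<^sup>2" by simp
    then have "1\<^sup>2 \<le> (norm u)\<^sup>2" using zero_le_power2[of \<rho>] unfolding one_power2 by linarith
    then have u1: "norm u \<ge> 1" by (rule power2_le_imp_le) simp
    then have u0: "u \<noteq> 0" by auto
    define n where "n = u /\<^sub>R norm u"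
    have n1: "norm n = 1" unfolding n_def using u0 by simp
    have un: "u \<bullet> w = norm u * (n \<bullet> w)" for w unfolding n_def using u0 by simp
    have r2: "\<rho>\<^sup>2 \<le> 1" using eta_le \<eta> by simp
    have "(\<rho> / norm u)\<^sup>2 \<le> 1/2"
      unfolding power_divide using ubig r2 u0 by (simp add: pos_divide_le_eq)
    then obtain e where e: "norm e = 1" "n \<bullet> e = \<rho> / norm u"
      and near: "norm (e - e0) \<le> 5 * \<bar>n \<bullet> e0 - \<rho> / norm u\<bar>"
      using unit_vector_with_prescribed_component[of n e0 "\<rho> / norm u"] n1 e0(1) by auto
    have ue: "u \<bullet> e = \<rho>" using un[of e] e(2) u0 by simp
    have "(n \<bullet> e0 - \<rho> / norm u) * norm u = u \<bullet> e0 - \<rho>"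
      unfolding un[of e0] using u0 by (simp add: field_simps)
    then have "\<bar>n \<bullet> e0 - \<rho> / norm u\<bar> * norm u = \<bar>u \<bullet> e0 - \<rho>\<bar>"
      by (metis abs_mult abs_norm_cancel)
    moreover have "\<bar>n \<bullet> e0 - \<rho> / norm u\<bar> * 1 \<le> \<bar>n \<bullet> e0 - \<rho> / norm u\<bar> * norm u"
      using u1 by (intro mult_left_mono) auto
    ultimately have near': "norm (e - e0) \<le> 5 * ((\<gamma> + 2) * x / \<eta>)" using near j0 by linarith
    \<comment> \<open>Nearly all of the positive part of the slack is cancelled by the gap of \<open>a + b\<close>, which is
      thus no smaller than a multiple of the gap of \<open>a\<close>.\<close>
    have xd: "\<eta> * x \<le> d"
    proof -
      have "\<eta> / 2 * x \<le> (1 - \<rho>) / 2 * x" using \<rho> x0 by (intro mult_right_mono) auto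
      moreover have "0 \<le> (1 + \<rho>) / 2 * y" using \<rho> y0 by auto
      moreover have "(1 - \<rho>\<^sup>2) / 4 * d \<le> 1 / 4 * d" using d2 \<delta>0 by (intro mult_right_mono) auto
      ultimately show ?thesis using False S by (simp add: field_simps)
    qed
    \<comment> \<open>The factor 41 in \<open>C\<close> is 1 from \<open>e0\<close> and \<open>2 * 5 * 4\<close> from the rotation.\<close>
    have "norm (a + b - 2 *\<^sub>R e) \<le> norm (a + b - 2 *\<^sub>R e0) + norm (2 *\<^sub>R (e0 - e))"
      by (rule order_trans[OF eq_refl norm_triangle_ineq]) (simp add: algebra_simps)
    also have "\<dots> \<le> \<delta> + 10 * (\<gamma> + 2) / \<eta> * x"
    proof -
      have "2 * (5 * ((\<gamma> + 2) * x / \<eta>)) = 10 * (\<gamma> + 2) / \<eta> * x" by simp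
      then show ?thesis using near' unfolding p0 norm_scaleR norm_minus_commute[of e0] by linarith
    qed
    also have "10 * (\<gamma> + 2) / \<eta> * x = 10 * (\<gamma> + 2) / \<eta>\<^sup>2 * (\<eta> * x)"
      using \<eta> by (simp add: field_simps power2_eq_square)
    also have "\<dots> \<le> 10 * (\<gamma> + 2) / \<eta>\<^sup>2 * (4 * \<delta>)" using xd d4 \<gamma> by (intro mult_left_mono) auto
    also have "\<delta> + \<dots> \<le> C * \<delta>"
    proof -
      have "1 \<le> (\<gamma> + 2) / \<eta>\<^sup>2" using \<gamma> \<eta> \<rho> power_le_one[of \<eta> 2] by (simp add: field_simps)
      then have "1 * \<delta> \<le> (\<gamma> + 2) / \<eta>\<^sup>2 * \<delta>" using \<delta>0 by (intro mult_right_mono) auto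
      moreover have "C * \<delta> = (\<gamma> + 2) / \<eta>\<^sup>2 * \<delta> + 10 * (\<gamma> + 2) / \<eta>\<^sup>2 * (4 * \<delta>)"
        unfolding C_def using \<eta> by (simp add: field_simps)
      ultimately show ?thesis by linarith
    qed
    finally have "norm (a + b - 2 *\<^sub>R e) \<le> C * \<delta>" by simp
    moreover have "\<bar>u \<bullet> e - \<rho>\<bar> \<le> C * S" using ue C1 E unfolding S_def by simp
    ultimately show ?thesis using e by blast
  qed
  then obtain e where e: "norm e = 1" "norm (a + b - 2 *\<^sub>R e) \<le> C * \<delta>" "\<bar>u \<bullet> e - \<rho>\<bar> \<le> C * S" by blast
  have "C * \<delta> \<le> C * (2 / \<eta> * x)"
  proof (rule mult_left_mono)
    have "\<eta> * (2 * \<delta>) \<le> \<eta> * d" using d2 \<eta> by (intro mult_left_mono) auto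
    then have "\<delta> * \<eta> \<le> 2 * x" using dx by (simp add: mult_ac)
    then show "\<delta> \<le> 2 / \<eta> * x" using \<eta> by (simp add: pos_le_divide_eq)
  qed (use C1 in simp)
  then have "norm (a + b - 2 *\<^sub>R e) \<le> 2 * C / \<eta> * x" using e(2) by (simp add: mult_ac)
  then show ?thesis using that e unfolding \<delta>_def x_def S_def by blast
qed

section \<open>Stable directions\<close>

lemma mix_add_direction:
  fixes a b e :: "real^2"
  assumes "1 - \<rho> - t \<noteq> 0"
  shows "mix \<rho> a b + t *\<^sub>R (1, e, (1/2) *\<^sub>R (b - e))
       = mix (\<rho> + t) (a + (t / (1 - \<rho> - t)) *\<^sub>R (a + b - 2 *\<^sub>R e)) b"
proof -
  have "(1 - (\<rho> + t)) *\<^sub>R (a + (t / (1 - \<rho> - t)) *\<^sub>R (a + b - 2 *\<^sub>R e))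
      = (1 - \<rho> - t) *\<^sub>R a + t *\<^sub>R (a + b - 2 *\<^sub>R e)"
    using assms by (simp add: scaleR_add_right diff_diff_eq)
  then show ?thesis
    unfolding mix_def by (simp only:) (simp add: vec_eq_iff field_simps)
qed

text \<open>Each gap shrinks along the line at a rate bounded by a multiple of the gap itself, so all of
  them stay positive for a time that does not depend on how close the state is to the boundary of
  \<open>U \<gamma>\<close>.\<close>

lemma stable_direction_ordered:
  fixes a b :: "real^2"
  assumes \<gamma>: "\<gamma> > 2" and \<eta>: "0 < \<eta>" "\<eta> \<le> 1 - \<bar>\<rho>\<bar>"
    and z: "mix \<rho> a b \<in> U \<gamma>" and ab: "norm a \<le> norm b"
  defines "\<beta> \<equiv> \<eta> ^ 4 / (328 * \<gamma> * (\<gamma> + 2))"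
  obtains w where "w \<in> Lambda" "norm w \<ge> 1" "\<And>t. \<bar>t\<bar> < \<beta> \<Longrightarrow> mix \<rho> a b + t *\<^sub>R w \<in> U \<gamma>"
proof -
  define C where "C = 41 * (\<gamma> + 2) / \<eta>\<^sup>2"
  have \<rho>: "\<bar>\<rho>\<bar> < 1" "\<eta> \<le> 1" using \<eta> by auto
  have z': "norm a < \<gamma>" "norm b < \<gamma>" "norm (a + b) < 2" "slack \<gamma> \<rho> a b > 0"
    using z mix_in_U_iff[OF \<rho>(1)] by blast+
  define u where "u = (1/2) *\<^sub>R ((1 + \<rho>) *\<^sub>R b - (1 - \<rho>) *\<^sub>R a)"
  obtain e where e: "norm e = 1"
    "norm (a + b - 2 *\<^sub>R e) \<le> C * (2 - norm (a + b))"
    "norm (a + b - 2 *\<^sub>R e) \<le> 2 * C / \<eta> * (\<gamma>\<^sup>2 - (norm a)\<^sup>2)"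
    "\<bar>u \<bullet> e - \<rho>\<bar> \<le> C * slack \<gamma> \<rho> a b"
    using unit_vector_controlled_by_slacks[OF \<gamma> \<eta> z'(1) ab z'(2-4)] unfolding u_def C_def by blast
  define p where "p = a + b - 2 *\<^sub>R e"
  define w where "w = (1::real, e, (1/2) *\<^sub>R (b - e))"
  have C1: "C \<ge> 1"
    unfolding C_def using \<gamma> \<eta> power_le_one[of \<eta> 2] \<rho> by (simp add: field_simps)
  \<comment> \<open>The step is dictated by the gap of \<open>a\<close>: the displacement of \<open>a\<close> is at most
    \<open>4 C \<beta> / \<eta>\<^sup>2\<close> times \<open>\<gamma>\<^sup>2 - (norm a)\<^sup>2 \<le> 2 \<gamma> (\<gamma> - norm a)\<close>.\<close>
  have \<beta>: "\<beta> = \<eta>\<^sup>2 / (8 * C * \<gamma>)"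
    unfolding \<beta>_def C_def using \<eta> \<gamma> by (simp add: field_simps flip: power_add)
  have b1: "8 * C * \<gamma> * \<beta> = \<eta>\<^sup>2" unfolding \<beta> using C1 \<gamma> by simp
  have \<beta>0: "\<beta> > 0" unfolding \<beta> using C1 \<gamma> \<eta> by simp
  have b2: "16 * C * \<beta> \<le> \<eta>\<^sup>2"
  proof -
    have "8 * C * \<beta> * 2 \<le> 8 * C * \<beta> * \<gamma>" using \<gamma> C1 \<beta>0 by (intro mult_left_mono) auto
    then show ?thesis using b1 by (simp add: mult_ac)
  qed
  have b3: "16 * \<beta> \<le> \<eta>\<^sup>2"
  proof -
    have "1 * (16 * \<beta>) \<le> C * (16 * \<beta>)" using C1 \<beta>0 by (intro mult_right_mono) auto
    then show ?thesis using b2 by (simp add: mult_ac)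
  qed
  have \<eta>2: "\<eta>\<^sup>2 \<le> \<eta>" using \<eta> \<rho> by (simp add: power2_eq_square mult_left_le_one_le)
  show ?thesis
  proof (rule that)
    show "w \<in> Lambda" unfolding w_def Lambda_def using e(1) by simp
    show "norm w \<ge> 1" using norm_fst_le[of "1::real"] unfolding w_def by simp
    fix t :: real assume t: "\<bar>t\<bar> < \<beta>"
    have q: "1 - \<rho> - t \<ge> \<eta> / 2" and \<rho>t: "\<bar>\<rho> + t\<bar> < 1"
      using t b3 \<eta>2 \<eta> by (auto simp: abs_if split: if_splits)
    then have q0: "1 - \<rho> - t > 0" using \<eta> by auto
    \<comment> \<open>The displacement of \<open>a\<close> in units of \<open>p\<close>; its denominator is the new weight of \<open>a\<close>, doubled.\<close>
    define \<tau> where "\<tau> = t / (1 - \<rho> - t)"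
    have \<tau>: "\<bar>\<tau>\<bar> \<le> 2 * \<beta> / \<eta>"
    proof -
      have "\<bar>\<tau>\<bar> = \<bar>t\<bar> / (1 - \<rho> - t)" unfolding \<tau>_def using q0 by simp
      also have "\<dots> \<le> \<beta> / (\<eta> / 2)" using q t \<eta> by (intro frac_le) auto
      finally show ?thesis by (simp add: mult.commute)
    qed
    have small: "norm (\<tau> *\<^sub>R p) \<le> 2 * \<beta> / \<eta> * norm p"
      unfolding norm_scaleR using \<tau> by (intro mult_right_mono) auto
    have eq: "mix \<rho> a b + t *\<^sub>R w = mix (\<rho> + t) (a + \<tau> *\<^sub>R p) b"
      unfolding w_def p_def \<tau>_def using mix_add_direction q0 by auto
    have "norm (a + \<tau> *\<^sub>R p) < \<gamma>"
    proof -
      have "norm (\<tau> *\<^sub>R p) \<le> 2 * \<beta> / \<eta> * (2 * C / \<eta> * (\<gamma>\<^sup>2 - (norm a)\<^sup>2))"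
        by (rule order_trans[OF small mult_left_mono[OF e(3)[folded p_def]]]) (use \<beta>0 \<eta> in simp)
      also have "\<dots> = (4 * C * \<beta> / \<eta>\<^sup>2) * (\<gamma>\<^sup>2 - (norm a)\<^sup>2)" by (simp add: power2_eq_square)
      also have "4 * C * \<beta> / \<eta>\<^sup>2 = 1 / (2 * \<gamma>)"
        using b1 \<gamma> \<eta> by (simp add: field_simps)
      also have "1 / (2 * \<gamma>) * (\<gamma>\<^sup>2 - (norm a)\<^sup>2) = (\<gamma> - norm a) * ((\<gamma> + norm a) / (2 * \<gamma>))"
        by (simp add: power2_eq_square algebra_simps diff_divide_distrib add_divide_distrib)
      also have "\<dots> < (\<gamma> - norm a) * 1"
        using z'(1) \<gamma> by (intro mult_strict_left_mono) (auto simp: field_simps)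
      finally show ?thesis using norm_triangle_ineq[of a "\<tau> *\<^sub>R p"] by simp
    qed
    moreover have "norm (a + \<tau> *\<^sub>R p + b) < 2"
    proof -
      have "norm (\<tau> *\<^sub>R p) \<le> 2 * \<beta> / \<eta> * (C * (2 - norm (a + b)))"
        by (rule order_trans[OF small mult_left_mono[OF e(2)[folded p_def]]]) (use \<beta>0 \<eta> in simp)
      also have "\<dots> = (2 * C * \<beta> / \<eta>) * (2 - norm (a + b))" by simp
      also have "\<dots> < 1 * (2 - norm (a + b))"
        using z'(3) b2 \<eta>2 \<eta> by (intro mult_strict_right_mono) (auto simp: field_simps)
      finally show ?thesis using norm_triangle_ineq[of "a + b" "\<tau> *\<^sub>R p"] by (simp add: algebra_simps)
    qed
    moreover have "slack \<gamma> (\<rho> + t) (a + \<tau> *\<^sub>R p) b > 0"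
    proof -
      let ?u' = "(1/2) *\<^sub>R ((1 + (\<rho> + t)) *\<^sub>R b - (1 - (\<rho> + t)) *\<^sub>R (a + \<tau> *\<^sub>R p))"
      have "?u' = fst (snd (mix (\<rho> + t) (a + \<tau> *\<^sub>R p) b))" unfolding mix_def by simp
      also have "\<dots> = u + t *\<^sub>R e" unfolding eq[symmetric] by (simp add: w_def mix_def u_def)
      finally have u': "?u' = u + t *\<^sub>R e" .
      have ee: "e \<bullet> e = 1" using e(1) by (simp add: norm_eq_1)
      \<comment> \<open>The quadratic terms of \<open>(norm u)\<^sup>2\<close> and \<open>\<rho>\<^sup>2\<close> cancel, so the slack is affine in \<open>t\<close>.\<close>
      have "(norm (u + t *\<^sub>R e))\<^sup>2 = (norm u)\<^sup>2 + 2 * t * (u \<bullet> e) + t\<^sup>2"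
        unfolding power2_norm_eq_inner
        by (simp add: inner_add_left inner_add_right ee inner_commute[of e u] power2_eq_square algebra_simps)
      then have "slack \<gamma> (\<rho> + t) (a + \<tau> *\<^sub>R p) b = slack \<gamma> \<rho> a b - 2 * t * (u \<bullet> e - \<rho>)"
        using norm_velocity_mix[of "\<rho> + t" b "a + \<tau> *\<^sub>R p" \<gamma>] norm_velocity_mix[of \<rho> b a \<gamma>]
        unfolding u' u_def[symmetric] by (simp add: power2_eq_square algebra_simps)
      moreover have "\<bar>2 * t * (u \<bullet> e - \<rho>)\<bar> < slack \<gamma> \<rho> a b"
      proof -
        have "\<bar>2 * t * (u \<bullet> e - \<rho>)\<bar> \<le> 2 * \<beta> * (C * slack \<gamma> \<rho> a b)"
          unfolding abs_mult using t e(4) by (intro mult_mono) auto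
        also have "\<dots> = (2 * C * \<beta>) * slack \<gamma> \<rho> a b" by simp
        also have "\<dots> < 1 * slack \<gamma> \<rho> a b"
          using z'(4) b2 \<eta>2 \<rho> \<eta> by (intro mult_strict_right_mono) auto
        finally show ?thesis by simp
      qed
      ultimately show ?thesis by linarith
    qed
    ultimately show "mix \<rho> a b + t *\<^sub>R w \<in> U \<gamma>"
      unfolding eq using mix_in_U_iff[OF \<rho>t] z'(2) by blast
  qed
qed

section \<open>The reflection that interchanges the endpoints\<close>

definition reflect :: "state \<Rightarrow> state" where
  "reflect = (\<lambda>(\<rho>, u, m). (- \<rho>, - u, m))"

lemma reflect_mix: "reflect (mix \<rho> a b) = mix (- \<rho>) b a"
  unfolding reflect_def mix_def by (simp add: vec_eq_iff field_simps)

lemma reflect_add_scaleR: "reflect (z + t *\<^sub>R w) = reflect z + t *\<^sub>R reflect w"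
  unfolding reflect_def by (simp split: prod.splits)

lemma norm_reflect [simp]: "norm (reflect z) = norm z"
  unfolding reflect_def by (cases z) (simp add: norm_Pair)

lemma reflect_in_Lambda_iff [simp]: "reflect z \<in> Lambda \<longleftrightarrow> z \<in> Lambda"
  unfolding reflect_def Lambda_def by (cases z) simp

lemma reflect_in_K_iff [simp]: "reflect z \<in> K \<gamma> \<longleftrightarrow> z \<in> K \<gamma>"
  unfolding reflect_def K_def by (cases z) simp

lemma reflect_in_U_iff [simp]: "reflect z \<in> U \<gamma> \<longleftrightarrow> z \<in> U \<gamma>"
  unfolding reflect_def U_def by (cases z) auto

lemma reflect_reflect [simp]: "reflect (reflect z) = z"
  unfolding reflect_def by (cases z) simp

lemma infdist_reflect: "infdist (reflect z) (K \<gamma>) = infdist z (K \<gamma>)"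
proof -
  have "reflect ` K \<gamma> = K \<gamma>"
  proof (rule set_eqI)
    show "y \<in> reflect ` K \<gamma> \<longleftrightarrow> y \<in> K \<gamma>" for y
      using image_eqI[of y reflect "reflect y" "K \<gamma>"] by auto
  qed
  moreover have "dist (reflect z) (reflect y) = dist z y" for y
    using reflect_add_scaleR[of z "- 1" y] norm_reflect[of "z - y"] by (simp add: dist_norm)
  then have "infdist (reflect z) (reflect ` K \<gamma>) = infdist z (K \<gamma>)"
    unfolding infdist_def by (simp add: image_image)
  ultimately show ?thesis by simp
qed

lemma stable_direction:
  fixes a b :: "real^2"
  assumes \<gamma>: "\<gamma> > 2" and \<eta>: "0 < \<eta>" "\<eta> \<le> 1 - \<bar>\<rho>\<bar>" and z: "mix \<rho> a b \<in> U \<gamma>"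
  obtains w where "w \<in> Lambda" "norm w \<ge> 1"
    "\<And>t. \<bar>t\<bar> < \<eta> ^ 4 / (328 * \<gamma> * (\<gamma> + 2)) \<Longrightarrow> mix \<rho> a b + t *\<^sub>R w \<in> U \<gamma>"
proof (cases "norm a \<le> norm b")
  case True
  then show ?thesis using stable_direction_ordered[OF \<gamma> \<eta> z] that by blast
next
  case False
  have "mix (- \<rho>) b a \<in> U \<gamma>" using z by (simp flip: reflect_mix)
  moreover have "\<eta> \<le> 1 - \<bar>- \<rho>\<bar>" "norm b \<le> norm a" using \<eta>(2) False by simp_all
  ultimately obtain w where w: "w \<in> Lambda" "norm w \<ge> 1"
    "\<And>t. \<bar>t\<bar> < \<eta> ^ 4 / (328 * \<gamma> * (\<gamma> + 2)) \<Longrightarrow> mix (- \<rho>) b a + t *\<^sub>R w \<in> U \<gamma>"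
    using stable_direction_ordered[OF \<gamma> \<eta>(1), of "- \<rho>" b a] by blast
  show ?thesis
  proof (rule that[of "reflect w"])
    fix t :: real assume "\<bar>t\<bar> < \<eta> ^ 4 / (328 * \<gamma> * (\<gamma> + 2))"
    from w(3)[OF this] have "reflect (mix (- \<rho>) b a + t *\<^sub>R w) \<in> U \<gamma>" by simp
    then show "mix \<rho> a b + t *\<^sub>R reflect w \<in> U \<gamma>"
      by (simp add: reflect_add_scaleR reflect_mix)
  qed (use w in simp_all)
qed

theorem proposition3p3:
  fixes \<gamma> :: real
  assumes "\<gamma> > 2"
  shows "\<forall>\<alpha>>0. \<exists>\<beta>>0. \<forall>z\<in>U \<gamma>. infdist z (K \<gamma>) \<ge> \<alpha> \<longrightarrow>
           (\<exists>zbar\<in>Lambda. norm zbar = 1 \<and> (\<forall>t::real. \<bar>t\<bar> < \<beta> \<longrightarrow> z + t *\<^sub>R zbar \<in> U \<gamma>))"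
proof (intro allI impI)
  fix \<alpha> :: real assume \<alpha>: "\<alpha> > 0"
  define \<eta> where "\<eta> = \<alpha> / (2 + \<gamma>)"
  define \<beta> where "\<beta> = \<eta> ^ 4 / (328 * \<gamma> * (\<gamma> + 2))"
  have \<eta>0: "\<eta> > 0" unfolding \<eta>_def using \<alpha> assms by simp
  then have "\<beta> > 0" unfolding \<beta>_def using assms by simp
  moreover have "\<exists>zbar\<in>Lambda. norm zbar = 1 \<and> (\<forall>t::real. \<bar>t\<bar> < \<beta> \<longrightarrow> z + t *\<^sub>R zbar \<in> U \<gamma>)"
    if z: "z \<in> U \<gamma>" and far: "infdist z (K \<gamma>) \<ge> \<alpha>" for z
  proof -
    obtain \<rho> u m where "z = (\<rho>, u, m)" by (cases z)
    moreover from this have \<rho>: "\<bar>\<rho>\<bar> < 1" using z unfolding U_def by simp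
    ultimately obtain a b where zab: "z = mix \<rho> a b" using state_eq_mix by metis
    have "norm a \<le> \<gamma>" "norm b \<le> \<gamma>" "norm (a + b) \<le> 2"
      using z mix_in_U_iff[OF \<rho>] unfolding zab by (auto simp: less_imp_le)
    \<comment> \<open>The second bound is the distance to the endpoint with density \<open>-1\<close>, seen after reflection.\<close>
    then have "\<alpha> \<le> (1 - \<rho>) * (2 + \<gamma>)" "\<alpha> \<le> (1 - (- \<rho>)) * (2 + \<gamma>)"
      using far infdist_mix_le[of \<rho> a \<gamma> b] infdist_mix_le[of "- \<rho>" b \<gamma> a] \<rho>
        infdist_reflect[of z \<gamma>] unfolding zab reflect_mix by (auto simp: add.commute)
    then have "\<eta> \<le> 1 - \<rho>" "\<eta> \<le> 1 - (- \<rho>)"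
      unfolding \<eta>_def using assms by (simp_all add: pos_divide_le_eq)
    then have "\<eta> \<le> 1 - \<bar>\<rho>\<bar>" by simp
    from stable_direction[OF assms \<eta>0 this z[unfolded zab]]
    obtain w where w: "w \<in> Lambda" "norm w \<ge> 1"
      "\<And>t. \<bar>t\<bar> < \<beta> \<Longrightarrow> z + t *\<^sub>R w \<in> U \<gamma>"
      unfolding zab \<beta>_def by blast
    \<comment> \<open>Since \<open>norm w \<ge> 1\<close>, normalising \<open>w\<close> only slows the motion down.\<close>
    have "w /\<^sub>R norm w \<in> Lambda"
      using w(1) unfolding Lambda_def by (cases w) (simp add: power_mult_distrib abs_mult)
    moreover have "norm w \<noteq> 0" using w(2) by linarith
    then have "norm (w /\<^sub>R norm w) = 1" by simp
    moreover have "z + t *\<^sub>R (w /\<^sub>R norm w) \<in> U \<gamma>" if t: "\<bar>t\<bar> < \<beta>" for t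
    proof -
      have "\<bar>t / norm w\<bar> \<le> \<bar>t\<bar>" 
        unfolding abs_divide abs_norm_cancel using w(2) by (simp add: divide_le_eq mult_le_cancel_left1)
      then have "z + (t / norm w) *\<^sub>R w \<in> U \<gamma>" using w(3) t by simp
      then show ?thesis by (simp add: divide_inverse)
    qed
    ultimately show ?thesis by blast
  qed
  ultimately show "\<exists>\<beta>>0. \<forall>z\<in>U \<gamma>. infdist z (K \<gamma>) \<ge> \<alpha> \<longrightarrow>
           (\<exists>zbar\<in>Lambda. norm zbar = 1 \<and> (\<forall>t::real. \<bar>t\<bar> < \<beta> \<longrightarrow> z + t *\<^sub>R zbar \<in> U \<gamma>))"
    by blast
qed

end
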